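(* Let $\Xi_3$ be the set of all $\lambda\in\mathbb{C}$ such that $\lambda$ is an eigenvalue of some $3\times 3$ monotone matrix. Then $\Xi_3=[-\tfrac12,1]$ (the real closed interval, viewed as a subset of $\mathbb{C}$).
   Context: A stochastic matrix is a (real) entrywise non-negative square matrix each of whose row sums equals $1$. An $n\times n$ monotone matrix is an $n\times n$ stochastic matrix $M=(m_{ij})$ such that $\sum_{j=r}^n m_{lj}\ge\sum_{j=r}^n m_{kj}$ for all $l>k$ in $\{1,\dots,n\}$ and all $r\in\{1,\dots,n\}$. *)

theory Defs
  imports Complex_Main "Jordan_Normal_Form.Char_Poly"
begin

text \<open>Rows and columns are numbered \<open>0, \<dots>, n - 1\<close>, following the library's matrix type.\<close>

definition stochastic_mat :: "nat \<Rightarrow> real mat \<Rightarrow> bool" where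
  "stochastic_mat n M \<longleftrightarrow>
     M \<in> carrier_mat n n \<and>
     (\<forall>i<n. \<forall>j<n. 0 \<le> M $$ (i, j)) \<and>
     (\<forall>i<n. (\<Sum>j<n. M $$ (i, j)) = 1)"

definition monotone_mat :: "nat \<Rightarrow> real mat \<Rightarrow> bool" where
  "monotone_mat n M \<longleftrightarrow>
     stochastic_mat n M \<and>
     (\<forall>k<n. \<forall>l<n. \<forall>r<n. k < l \<longrightarrow>
        (\<Sum>j=r..<n. M $$ (k, j)) \<le> (\<Sum>j=r..<n. M $$ (l, j)))"

text \<open>Eigenvalues are complex, so the real matrix is regarded as a complex one.\<close>

definition Xi :: "nat \<Rightarrow> complex set" where
  "Xi n = {z. \<exists>M. monotone_mat n M \<and> eigenvalue (map_mat complex_of_real M) z}"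

end

(* With s_k and t_k the sums of row k over the last two columns and the last column, passing to
   successive differences of an eigenvector shows that each eigenvalue of M is either 1 or an
   eigenvalue of the nonnegative matrix with rows (a, b) = (s_1 - s_0, t_1 - t_0) and
   (c, d) = (s_2 - s_1, t_2 - t_1).  A nonnegative 2x2 matrix has real eigenvalues; they are at
   most 1 because a + c and b + d are, and at least -1/2 because b <= t_1 <= s_1 and
   c <= 1 - s_1 give bc <= 1/4. *)
theory Submission
  imports Defs
begin

lemma All_less_3: "(\<forall>i<3. P i) \<longleftrightarrow> P 0 \<and> P 1 \<and> P (2::nat)"
  by (auto simp: numeral_eq_Suc less_Suc_eq)

lemma sum_lessThan_3:
  fixes f :: "nat \<Rightarrow> 'a::comm_monoid_add"
  shows "(\<Sum>j<3. f j) = f 0 + f 1 + f 2"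
  by (simp add: numeral_eq_Suc)

lemma sum_tails_3:
  fixes f :: "nat \<Rightarrow> 'a::comm_monoid_add"
  shows "sum f {0..<3} = f 0 + f 1 + f 2"
    and "sum f {1..<3} = f 1 + f 2"
    and "sum f {2..<3} = f 2"
  by (simp_all add: numeral_eq_Suc)

text \<open>Tails starting at column 0 all equal 1, and rows 0 and 2 compare by transitivity through
  row 1, so four inequalities between adjacent rows remain.\<close>

lemma monotone_mat_3_iff:
  "monotone_mat 3 M \<longleftrightarrow>
     M \<in> carrier_mat 3 3 \<and>
     (\<forall>i<3. \<forall>j<3. 0 \<le> M $$ (i, j)) \<and>
     (\<forall>i<3. M $$ (i, 0) + M $$ (i, 1) + M $$ (i, 2) = 1) \<and>
     M $$ (0, 1) + M $$ (0, 2) \<le> M $$ (1, 1) + M $$ (1, 2) \<and>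
     M $$ (1, 1) + M $$ (1, 2) \<le> M $$ (2, 1) + M $$ (2, 2) \<and>
     M $$ (0, 2) \<le> M $$ (1, 2) \<and> M $$ (1, 2) \<le> M $$ (2, 2)"
  unfolding monotone_mat_def stochastic_mat_def sum_lessThan_3 All_less_3 sum_tails_3
  by auto

text \<open>Taking the eigenvector as a function on indices turns both inclusions into work with
  three scalar equations.\<close>

lemma eigenvalue_3_iff:
  fixes A :: "'a::field mat"
  assumes A: "A \<in> carrier_mat 3 3"
  shows "eigenvalue A z \<longleftrightarrow>
    (\<exists>v. (v 0 \<noteq> 0 \<or> v 1 \<noteq> 0 \<or> v (2::nat) \<noteq> 0) \<and>
      (\<forall>i<3. A $$ (i, 0) * v 0 + A $$ (i, 1) * v 1 + A $$ (i, 2) * v 2 = z * v i))"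
proof -
  have dim: "dim_row A = 3" "dim_col A = 3" using A by auto
  have eq: "A *\<^sub>v v = z \<cdot>\<^sub>v v \<longleftrightarrow>
      (\<forall>i<3. A $$ (i, 0) * v $ 0 + A $$ (i, 1) * v $ 1 + A $$ (i, 2) * v $ 2 = z * v $ i)"
    if v: "v \<in> carrier_vec 3" for v
  proof -
    have "(A *\<^sub>v v) $ i = A $$ (i, 0) * v $ 0 + A $$ (i, 1) * v $ 1 + A $$ (i, 2) * v $ 2"
      if "i < 3" for i
      using that v dim by (simp add: scalar_prod_def sum_tails_3)
    then show ?thesis using v dim by (auto simp: vec_eq_iff simp del: index_mult_mat_vec)
  qed
  have nz: "v \<noteq> 0\<^sub>v 3 \<longleftrightarrow> v $ 0 \<noteq> 0 \<or> v $ 1 \<noteq> 0 \<or> v $ 2 \<noteq> 0" if "v \<in> carrier_vec 3" for v :: "'a vec"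
    using that All_less_3[of "\<lambda>i. v $ i = 0"] by (auto simp: vec_eq_iff)
  show ?thesis
  proof
    assume "eigenvalue A z"
    then obtain v where v: "v \<in> carrier_vec 3" "v \<noteq> 0\<^sub>v 3" "A *\<^sub>v v = z \<cdot>\<^sub>v v"
      by (auto simp: eigenvalue_def eigenvector_def dim)
    then show "\<exists>v. (v 0 \<noteq> 0 \<or> v 1 \<noteq> 0 \<or> v (2::nat) \<noteq> 0) \<and>
      (\<forall>i<3. A $$ (i, 0) * v 0 + A $$ (i, 1) * v 1 + A $$ (i, 2) * v 2 = z * v i)"
      using eq nz by (intro exI[of _ "\<lambda>i. v $ i"]) simp
  next
    assume "\<exists>v. (v 0 \<noteq> 0 \<or> v 1 \<noteq> 0 \<or> v (2::nat) \<noteq> 0) \<and>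
      (\<forall>i<3. A $$ (i, 0) * v 0 + A $$ (i, 1) * v 1 + A $$ (i, 2) * v 2 = z * v i)"
    then obtain v where "v 0 \<noteq> 0 \<or> v 1 \<noteq> 0 \<or> v (2::nat) \<noteq> 0"
      "\<forall>i<3. A $$ (i, 0) * v 0 + A $$ (i, 1) * v 1 + A $$ (i, 2) * v 2 = z * v i" by blast
    then have "vec 3 v \<noteq> 0\<^sub>v 3" "A *\<^sub>v vec 3 v = z \<cdot>\<^sub>v vec 3 v"
      using eq[of "vec 3 v"] nz[of "vec 3 v"] by auto
    then show "eigenvalue A z"
      unfolding eigenvalue_def eigenvector_def dim by (intro exI[of _ "vec 3 v"]) simp
  qed
qed

text \<open>The root equation is the characteristic equation of the matrix with rows
  \<open>(a, b)\<close> and \<open>(c, d)\<close>. If \<open>Im z\<close> were nonzero, the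
  imaginary part of the equation would put \<open>Re z\<close> at the midpoint of \<open>a\<close>
  and \<open>d\<close>, and the real part would then make \<open>b * c\<close> negative.\<close>

lemma Im_root_nonneg_2x2:
  fixes a b c d :: real and z :: complex
  assumes "0 \<le> b * c" and root: "(z - of_real a) * (z - of_real d) = of_real (b * c)"
  shows "Im z = 0"
proof (rule ccontr)
  assume nz: "Im z \<noteq> 0"
  have "Im z * (2 * Re z - a - d) = 0"
    using arg_cong[OF root, of Im] by (simp add: algebra_simps)
  with nz have "2 * Re z = a + d" by simp
  then have d: "d = 2 * Re z - a" by simp
  have "(Re z - a) * (Re z - d) - Im z * Im z = b * c"
    using arg_cong[OF root, of Re] by simp
  then have "- (Re z - a)\<^sup>2 - (Im z)\<^sup>2 = b * c"
    unfolding d by (simp add: power2_eq_square algebra_simps)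
  moreover have "0 < (Im z)\<^sup>2" using nz by simp
  ultimately show False using \<open>0 \<le> b * c\<close> by (smt (verit) zero_le_power2)
qed

text \<open>Outside the interval the left side of \<open>root\<close> is too large. For
  \<open>x < -1/2\<close> both \<open>a - x\<close> and \<open>d - x\<close> exceed 1/2, while
  \<open>b * c <= 1/4\<close> since \<open>b + c <= 1\<close>. For \<open>x > 1\<close> the factors
  \<open>x - a\<close> and \<open>x - d\<close> exceed \<open>c\<close> and \<open>b\<close>
  respectively.\<close>

lemma root_bounds_2x2:
  fixes a b c d x :: real
  assumes nonneg: "0 \<le> a" "0 \<le> b" "0 \<le> c" "0 \<le> d"
    and sums: "a + c \<le> 1" "b + d \<le> 1" "b + c \<le> 1"
    and root: "(x - a) * (x - d) = b * c"
  shows "- 1 / 2 \<le> x" "x \<le> 1"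
proof -
  show "- 1 / 2 \<le> x"
  proof (rule ccontr)
    assume "\<not> - 1 / 2 \<le> x"
    then have "1 / 2 * (1 / 2) < (a - x) * (d - x)"
      using nonneg by (intro mult_strict_mono) auto
    moreover have "b * c \<le> 1 / 4"
    proof -
      have "(b + c)\<^sup>2 \<le> 1" using nonneg sums by (simp add: power_le_one)
      moreover have "4 * (b * c) = (b + c)\<^sup>2 - (b - c)\<^sup>2"
        by (simp add: power2_eq_square algebra_simps)
      ultimately show ?thesis using zero_le_power2[of "b - c"] by linarith
    qed
    moreover have "(a - x) * (d - x) = b * c" using root by (simp add: algebra_simps)
    ultimately show False by simp
  qed
  show "x \<le> 1"
  proof (rule ccontr)
    assume "\<not> x \<le> 1"
    then have "c * b < (x - a) * (x - d)"
      using nonneg sums by (intro mult_strict_mono) auto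
    with root show False by (simp add: mult.commute)
  qed
qed

lemma Xi_3_subset: "Xi 3 \<subseteq> complex_of_real ` {- 1 / 2 .. 1}"
proof
  fix z assume "z \<in> Xi 3"
  then obtain M where mono: "monotone_mat 3 M" and ev: "eigenvalue (map_mat complex_of_real M) z"
    by (auto simp: Xi_def)
  note M = mono[unfolded monotone_mat_3_iff All_less_3]
  have carr: "map_mat complex_of_real M \<in> carrier_mat 3 3" using M by simp
  define s t where "s i = M $$ (i, 1) + M $$ (i, 2)" and "t i = M $$ (i, 2)" for i
  obtain v where v: "v 0 \<noteq> 0 \<or> v 1 \<noteq> 0 \<or> v (2::nat) \<noteq> 0"
    and rows: "\<forall>i<3. of_real (M $$ (i, 0)) * v 0 + of_real (M $$ (i, 1)) * v 1
      + of_real (M $$ (i, 2)) * v 2 = z * v i"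
  proof -
    have "dim_row M = 3" "dim_col M = 3" using M by auto
    with ev that show thesis unfolding eigenvalue_3_iff[OF carr] All_less_3 by auto
  qed
  \<comment> \<open>Summation by parts: the row sum 1 makes the coefficient of \<open>v 0\<close>
    the same in every row, so it cancels when adjacent rows are subtracted.\<close>
  have row: "v 0 + of_real (s i) * (v 1 - v 0) + of_real (t i) * (v 2 - v 1) = z * v i" if "i < 3" for i
  proof -
    have "M $$ (i, 0) + M $$ (i, 1) + M $$ (i, 2) = 1"
      using mono that by (simp add: monotone_mat_3_iff)
    then have eqs: "M $$ (i, 0) = 1 - s i" "M $$ (i, 1) = s i - t i" "M $$ (i, 2) = t i"
      by (simp_all add: s_def t_def)
    from rows that have "of_real (M $$ (i, 0)) * v 0 + of_real (M $$ (i, 1)) * v 1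
      + of_real (M $$ (i, 2)) * v 2 = z * v i" by blast
    then have "of_real (1 - s i) * v 0 + of_real (s i - t i) * v 1 + of_real (t i) * v 2 = z * v i"
      unfolding eqs .
    then show ?thesis by (simp add: algebra_simps)
  qed
  have e: "v 0 + of_real (s 0) * (v 1 - v 0) + of_real (t 0) * (v 2 - v 1) = z * v 0"
    "v 0 + of_real (s 1) * (v 1 - v 0) + of_real (t 1) * (v 2 - v 1) = z * v 1"
    "v 0 + of_real (s 2) * (v 1 - v 0) + of_real (t 2) * (v 2 - v 1) = z * v 2"
    by (rule row; simp)+
  define a b c d where "a = s 1 - s 0" and "b = t 1 - t 0" and "c = s 2 - s 1" and "d = t 2 - t 1"
  note defs = a_def b_def c_def d_def
  have nonneg: "0 \<le> a" "0 \<le> b" "0 \<le> c" "0 \<le> d"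
    using M by (auto simp: defs s_def t_def)
  \<comment> \<open>The first two sums telescope to \<open>s 2 - s 0\<close> and
    \<open>t 2 - t 0\<close>.\<close>
  have sums: "a + c \<le> 1" "b + d \<le> 1" "b + c \<le> 1"
    using M by (auto simp: defs s_def t_def)
  define p q where "p = v 1 - v 0" and "q = v 2 - v 1"
  show "z \<in> complex_of_real ` {- 1 / 2 .. 1}"
  proof (cases "p = 0 \<and> q = 0")
    case True
    then have "v 1 = v 0" "v 2 = v 0" by (auto simp: p_def q_def)
    with e(1) v have "z = complex_of_real 1" by auto
    then show ?thesis by simp
  next
    case False
    have "z * v 1 - z * v 0 = of_real a * p + of_real b * q"
      unfolding e[symmetric] defs p_def q_def by (simp add: algebra_simps)
    then have p: "(z - of_real a) * p = of_real b * q"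
      by (simp add: p_def algebra_simps)
    have "z * v 2 - z * v 1 = of_real c * p + of_real d * q"
      unfolding e[symmetric] defs p_def q_def by (simp add: algebra_simps)
    then have q: "(z - of_real d) * q = of_real c * p"
      by (simp add: q_def algebra_simps)
    \<comment> \<open>Eliminating one unknown at a time gives the same scalar equation multiplied by
      \<open>p\<close> and by \<open>q\<close>; whichever of the two is nonzero can be
      cancelled.\<close>
    have "(z - of_real a) * (z - of_real d) * p = of_real b * ((z - of_real d) * q)"
      using p by (simp add: mult_ac)
    moreover have "(z - of_real a) * (z - of_real d) * q = of_real c * ((z - of_real a) * p)"
      using q by (simp add: mult_ac)
    ultimately have "(z - of_real a) * (z - of_real d) * p = of_real (b * c) * p"
      "(z - of_real a) * (z - of_real d) * q = of_real (b * c) * q"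
      unfolding p q by (simp_all add: mult_ac)
    with False have root: "(z - of_real a) * (z - of_real d) = of_real (b * c)" by auto
    have "Im z = 0" using Im_root_nonneg_2x2[OF _ root] nonneg by simp
    then have z: "z = of_real (Re z)" by (simp add: complex_eq_iff)
    with root have "complex_of_real ((Re z - a) * (Re z - d)) = of_real (b * c)"
      by (metis of_real_diff of_real_mult)
    then have "(Re z - a) * (Re z - d) = b * c" by (simp only: of_real_eq_iff)
    from root_bounds_2x2[OF nonneg sums this] show ?thesis
      by (intro image_eqI[where x = "Re z"] z) simp
  qed
qed

text \<open>Packages a real matrix with a real eigenvector. Nonvanishing is asked at the middle
  coordinate, where both eigenvectors used below are nonzero.\<close>

lemma Xi_3I:
  fixes M :: "real mat" and v :: "nat \<Rightarrow> real"
  assumes "monotone_mat 3 M" and "v 1 \<noteq> 0"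
    and "\<forall>i<3. M $$ (i, 0) * v 0 + M $$ (i, 1) * v 1 + M $$ (i, 2) * v 2 = x * v i"
  shows "complex_of_real x \<in> Xi 3"
proof -
  have M: "M \<in> carrier_mat 3 3" using assms by (simp add: monotone_mat_3_iff)
  then have carr: "map_mat complex_of_real M \<in> carrier_mat 3 3" by simp
  have "eigenvalue (map_mat complex_of_real M) (of_real x)"
    unfolding eigenvalue_3_iff[OF carr]
    using assms(2,3) M
    by (intro exI[of _ "\<lambda>i. complex_of_real (v i)"]) (simp flip: of_real_mult of_real_add)
  with assms(1) show ?thesis by (auto simp: Xi_def)
qed

lemma of_real_mem_Xi_3:
  assumes "- 1 / 2 \<le> x" "x \<le> 1"
  shows "complex_of_real x \<in> Xi 3"
proof (cases "0 \<le> x")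
  case True
  \<comment> \<open>The middle column is \<open>x\<close> times the middle unit vector, which is
    therefore an eigenvector for \<open>x\<close>.\<close>
  define M where "M = mat_of_rows_list 3 [[1, 0, 0], [1 - x, x, 0], [1 - x, 0, x]]"
  show ?thesis
  proof (rule Xi_3I)
    show "monotone_mat 3 M"
      using True assms unfolding monotone_mat_3_iff All_less_3
      by (simp add: M_def mat_of_rows_list_def numeral_eq_Suc)
    show "\<forall>i<3. M $$ (i, 0) * of_bool (0 = (1::nat)) + M $$ (i, 1) * of_bool (1 = (1::nat))
        + M $$ (i, 2) * of_bool (2 = (1::nat)) = x * of_bool (i = 1)"
      unfolding All_less_3 by (simp add: M_def mat_of_rows_list_def numeral_eq_Suc)
  qed simp
next
  case False
  \<comment> \<open>Chosen so that the differences are \<open>a = d = 0\<close> and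
    \<open>b = c = - x\<close>, giving the eigenvalues \<open>x\<close> and \<open>- x\<close>. The
    entries \<open>1 / 2 + x\<close> are nonnegative exactly when \<open>x >= -1/2\<close>; at that
    endpoint \<open>b * c\<close> attains its bound 1/4.\<close>
  define M where "M = mat_of_rows_list 3
    [[1 / 2, 1 / 2, 0], [1 / 2, 1 / 2 + x, - x], [1 / 2 + x, 1 / 2, - x]]"
  \<comment> \<open>For the eigenvalue \<open>x\<close> the successive differences of
    \<open>v\<close> must be opposite, so \<open>v 0 = v 2\<close>; after scaling \<open>v 0\<close>
    to -1, row 0 determines \<open>v 1\<close>.\<close>
  define v where "v i = (if i = 1 then 1 - 2 * x else - 1)" for i :: nat
  show ?thesis
  proof (rule Xi_3I)
    show "monotone_mat 3 M"
      using False assms unfolding monotone_mat_3_iff All_less_3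
      by (simp add: M_def mat_of_rows_list_def eval_nat_numeral)
    show "v 1 \<noteq> 0" using False by (simp add: v_def)
    show "\<forall>i<3. M $$ (i, 0) * v 0 + M $$ (i, 1) * v 1 + M $$ (i, 2) * v 2 = x * v i"
      unfolding All_less_3
      by (simp add: M_def v_def mat_of_rows_list_def eval_nat_numeral algebra_simps)
  qed
qed

theorem theorem3p3:
  shows "Xi 3 = complex_of_real ` {- 1 / 2 .. 1}"
  using Xi_3_subset of_real_mem_Xi_3 by auto

end
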